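(* Let $(X,d)$ be an ultrametric space with at least two points. Then $(X,d)$ has a finite 2-metric basis if and only if $(X,d)$ is pseudo-complete, the set of partnered points of $X$ is finite and the set of unpartnered points of $X$ is empty.
   Context: A metric space $(X,d)$ is ultrametric if $d(x,y)\le\max\{d(x,z),d(z,y)\}$ for all $x,y,z\in X$. Points $x,y\in X$ are distinguished by $z\in X$ if $d(x,z)\neq d(y,z)$. A set $S\subseteq X$ is a 2-metric generator for $X$ if any pair of different points of $X$ is distinguished by at least 2 elements of $S$. A 2-metric basis is a 2-metric generator of minimum cardinality in $X$. Write $B_r(x)=\{p\in X: d(x,p)<r\}$, with $B_\infty(x)=X$. Two different points $x,y\in X$ are partners if $d(x,z)\ge d(x,y)$ and $d(y,z)\ge d(x,y)$ for all $z\in X\smallsetminus\{x,y\}$. A point $x$ is partnered if there is $y\in X$ such that $x,y$ are partners. A point $x$ is pseudopartnered if it is not partnered but there is $y\in X$, $y\ne x$, with $d(x,z)\ge d(x,y)$ for all $z\in X\smallsetminus\{x,y\}$. A point is unpartnered if it is neither partnered nor pseudopartnered. Given a pseudopartnered point $x$, an $x$-pseudopartnering sequence $(x_n)_{n\ge 1}$ with associated distances $(d_n)_{n\ge1}$ is any sequence obtained inductively as follows: $x_1=x$, $d_1=\infty$. Given $x_n,d_n$: if $|B_{d_n}(x_n)|=1$ or $d_n=0$, put $x_{n+1}=x_n$, $d_{n+1}=0$. If $|B_{d_n}(x_n)|>1$, let $I_n=\{d(x_n,z): z\in B_{d_n}(x_n)\smallsetminus\{x_n\}\}$; if $I_n$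 has no minimum put $x_{n+1}=x_n$, $d_{n+1}=0$; if $I_n$ has a minimum, choose any $x_{n+1}\in\{z\in X: d(x_n,z)=\min I_n\}$ and put $d_{n+1}=d(x_n,x_{n+1})$. A point $z\in X$ is a pseudolimit of a pseudopartnering sequence $(x_n)$ if $d(z,x_n)=d(x_n,x_{n+1})$ for every $n$. $(X,d)$ is pseudo-complete if for every pseudopartnered point $x\in X$: (i) every $x$-pseudopartnering sequence has a pseudolimit, and (ii) at least one $x$-pseudopartnering sequence has a finite number of pseudolimits. *)

theory Defs
  imports "HOL-Analysis.Analysis"
begin

locale Ultrametric_space = Metric_space +
  assumes ultrametric:
    "\<lbrakk>x \<in> M; y \<in> M; z \<in> M\<rbrakk> \<Longrightarrow> d x y \<le> max (d x z) (d z y)"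

definition distinguishes :: "('a \<Rightarrow> 'a \<Rightarrow> real) \<Rightarrow> 'a \<Rightarrow> 'a \<Rightarrow> 'a \<Rightarrow> bool" where
  "distinguishes d z x y \<longleftrightarrow> d x z \<noteq> d y z"

text \<open>``At least two elements'' is spelled out with two witnesses, because \<open>card\<close> is 0 on
  infinite sets.\<close>

definition two_metric_generator :: "'a set \<Rightarrow> ('a \<Rightarrow> 'a \<Rightarrow> real) \<Rightarrow> 'a set \<Rightarrow> bool" where
  "two_metric_generator X d S \<longleftrightarrow> S \<subseteq> X \<and>
     (\<forall>x\<in>X. \<forall>y\<in>X. x \<noteq> y \<longrightarrow>
       (\<exists>z\<in>S. \<exists>w\<in>S. z \<noteq> w \<and> distinguishes d z x y \<and> distinguishes d w x y))"

definition two_metric_basis :: "'a set \<Rightarrow> ('a \<Rightarrow> 'a \<Rightarrow> real) \<Rightarrow> 'a set \<Rightarrow> bool" where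
  "two_metric_basis X d S \<longleftrightarrow> two_metric_generator X d S \<and>
     (\<forall>T. two_metric_generator X d T \<longrightarrow> S \<lesssim> T)"

definition partners :: "'a set \<Rightarrow> ('a \<Rightarrow> 'a \<Rightarrow> real) \<Rightarrow> 'a \<Rightarrow> 'a \<Rightarrow> bool" where
  "partners X d x y \<longleftrightarrow> x \<in> X \<and> y \<in> X \<and> x \<noteq> y \<and>
     (\<forall>z\<in>X - {x, y}. d x z \<ge> d x y \<and> d y z \<ge> d x y)"

definition partnered :: "'a set \<Rightarrow> ('a \<Rightarrow> 'a \<Rightarrow> real) \<Rightarrow> 'a \<Rightarrow> bool" where
  "partnered X d x \<longleftrightarrow> x \<in> X \<and> (\<exists>y\<in>X. partners X d x y)"

definition pseudopartnered :: "'a set \<Rightarrow> ('a \<Rightarrow> 'a \<Rightarrow> real) \<Rightarrow> 'a \<Rightarrow> bool" where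
  "pseudopartnered X d x \<longleftrightarrow> x \<in> X \<and> \<not> partnered X d x \<and>
     (\<exists>y\<in>X. y \<noteq> x \<and> (\<forall>z\<in>X - {x, y}. d x z \<ge> d x y))"

definition unpartnered :: "'a set \<Rightarrow> ('a \<Rightarrow> 'a \<Rightarrow> real) \<Rightarrow> 'a \<Rightarrow> bool" where
  "unpartnered X d x \<longleftrightarrow> x \<in> X \<and> \<not> partnered X d x \<and> \<not> pseudopartnered X d x"

definition ext_ball :: "'a set \<Rightarrow> ('a \<Rightarrow> 'a \<Rightarrow> real) \<Rightarrow> ereal \<Rightarrow> 'a \<Rightarrow> 'a set" where
  "ext_ball X d r x = {p \<in> X. ereal (d x p) < r}"

definition is_minimum :: "real set \<Rightarrow> real \<Rightarrow> bool" where
  "is_minimum I m \<longleftrightarrow> m \<in> I \<and> (\<forall>i\<in>I. m \<le> i)"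

text \<open>\<open>pseudopartnering_step X d x r x' r'\<close>: the pair \<open>(x', r')\<close> of point and associated distance
  is an admissible successor of \<open>(x, r)\<close>. For \<open>r > 0\<close> the ball contains \<open>x\<close>, so the negation of
  the first condition says precisely that the ball has more than one element, including the case
  of an infinite ball (whose \<open>card\<close> is 0).\<close>

definition pseudopartnering_step ::
  "'a set \<Rightarrow> ('a \<Rightarrow> 'a \<Rightarrow> real) \<Rightarrow> 'a \<Rightarrow> ereal \<Rightarrow> 'a \<Rightarrow> ereal \<Rightarrow> bool" where
  "pseudopartnering_step X d x r x' r' \<longleftrightarrow>
     (let B = ext_ball X d r x; I = {d x z |z. z \<in> B - {x}} in
      if card B = 1 \<or> r = 0 then x' = x \<and> r' = 0
      else if \<exists>m. is_minimum I m
        then x' \<in> X \<and> is_minimum I (d x x') \<and> r' = ereal (d x x')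
        else x' = x \<and> r' = 0)"

text \<open>Sequences are indexed from 0: \<open>s n\<close> and \<open>r n\<close> stand for $x_{n+1}$ and $d_{n+1}$.\<close>

definition pseudopartnering_seq ::
  "'a set \<Rightarrow> ('a \<Rightarrow> 'a \<Rightarrow> real) \<Rightarrow> 'a \<Rightarrow> (nat \<Rightarrow> 'a) \<Rightarrow> (nat \<Rightarrow> ereal) \<Rightarrow> bool" where
  "pseudopartnering_seq X d x s r \<longleftrightarrow> s 0 = x \<and> r 0 = \<infinity> \<and>
     (\<forall>n. pseudopartnering_step X d (s n) (r n) (s (Suc n)) (r (Suc n)))"

definition pseudolimit :: "'a set \<Rightarrow> ('a \<Rightarrow> 'a \<Rightarrow> real) \<Rightarrow> (nat \<Rightarrow> 'a) \<Rightarrow> 'a \<Rightarrow> bool" where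
  "pseudolimit X d s z \<longleftrightarrow> z \<in> X \<and> (\<forall>n. d z (s n) = d (s n) (s (Suc n)))"

definition pseudo_complete :: "'a set \<Rightarrow> ('a \<Rightarrow> 'a \<Rightarrow> real) \<Rightarrow> bool" where
  "pseudo_complete X d \<longleftrightarrow> (\<forall>x. pseudopartnered X d x \<longrightarrow>
     (\<forall>s r. pseudopartnering_seq X d x s r \<longrightarrow> (\<exists>z. pseudolimit X d s z)) \<and>
     (\<exists>s r. pseudopartnering_seq X d x s r \<and> finite {z. pseudolimit X d s z}))"

end

theory Submission
  imports Defs
begin

text \<open>
  Everything is expressed through nearest neighbours: partners are two points that are nearest to
  each other, a pseudopartnered point has a nearest neighbour but no partner, and an unpartnered
  point has no nearest neighbour at all. In an ultrametric space a point distinguishes \<open>x\<close> from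
  \<open>y\<close> exactly when it lies in one of the disjoint open balls of radius \<open>d x y\<close> around \<open>x\<close> and \<open>y\<close>.
  Hence partners \<open>x\<close>, \<open>y\<close> are distinguished only by themselves, and every 2-metric generator
  contains all partnered points.

  Let \<open>S\<close> be a finite generator. A point \<open>x\<close> without nearest neighbour would have a point \<open>y\<close> closer
  to it than all of \<open>S - {x}\<close>, and then only \<open>x\<close> itself could distinguish \<open>x\<close> from \<open>y\<close>. If \<open>y\<close> is
  nearest to \<open>x\<close>, then the ball around \<open>x\<close> contains only \<open>x\<close>, so the ball around \<open>y\<close> meets \<open>S\<close>
  (\<open>nearest_ball_meets_generator\<close>). Along a pseudopartnering sequence that never stops these balls
  are nested, and since \<open>S\<close> is finite one of its points lies in all of them; it is a pseudolimit.
  Moreover, any point of that ball is also nearest to \<open>x\<close>, so the sequence can be chosen inside \<open>S\<close>;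
  as it cannot repeat a point before it stops, it stops and has a single pseudolimit.

  Conversely, assume the three conditions. The partnered points then form a generator, and being
  contained in every generator they form a basis. The decisive fact
  (\<open>pseudopartnered_near_partners\<close>) is that every pseudopartnered \<open>x\<close> has two nearest neighbours
  that are partners of each other. A pseudopartnering sequence that stops does so at a pair
  of partners. For one that does not stop, the nearest neighbours of a pseudolimit are again
  pseudolimits, so in a finite nonempty set of pseudolimits a shortest nearest-neighbour distance
  is realised by a pair of partners.
\<close>

section \<open>Nearest neighbours and partners\<close>

context Ultrametric_space
begin

definition nearest :: "'a \<Rightarrow> 'a \<Rightarrow> bool" where
  "nearest x y \<longleftrightarrow> x \<in> M \<and> y \<in> M \<and> y \<noteq> x \<and> (\<forall>z\<in>M - {x}. d x y \<le> d x z)"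

lemma nearestD:
  assumes "nearest x y"
  shows "x \<in> M" "y \<in> M" "y \<noteq> x" "0 < d x y" "\<And>z. z \<in> M \<Longrightarrow> z \<noteq> x \<Longrightarrow> d x y \<le> d x z"
  using assms unfolding nearest_def by auto

lemma nearest_cong:
  assumes "nearest x y" "z \<in> M" "d x z = d x y"
  shows "nearest x z"
  using assms unfolding nearest_def by auto

lemma partners_iff: "partners M d x y \<longleftrightarrow> nearest x y \<and> nearest y x"
  unfolding partners_def nearest_def by (auto simp: commute)

lemma partnered_iff: "partnered M d x \<longleftrightarrow> (\<exists>y. nearest x y \<and> nearest y x)"
  unfolding partnered_def partners_iff by (auto dest: nearestD)

lemma pseudopartnered_iff:
  "pseudopartnered M d x \<longleftrightarrow> \<not> partnered M d x \<and> (\<exists>y. nearest x y)"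
  unfolding pseudopartnered_def nearest_def by auto

lemma unpartnered_iff: "unpartnered M d x \<longleftrightarrow> x \<in> M \<and> (\<nexists>y. nearest x y)"
  unfolding unpartnered_def pseudopartnered_iff partnered_iff by auto

lemma isosceles:
  assumes "x \<in> M" "y \<in> M" "z \<in> M" "d x y < d y z"
  shows "d x z = d y z"
  using assms ultrametric[of x z y] ultrametric[of y z x] commute[of x y] by linarith

lemma distinguishes_iff:
  assumes "x \<in> M" "y \<in> M" "z \<in> M"
  shows "distinguishes d z x y \<longleftrightarrow> d x z < d x y \<or> d y z < d x y"
proof -
  have "d x z \<noteq> d y z" if "d x z < d x y"
    using isosceles[of z x y] assms that by (simp add: commute)
  moreover have "d x z \<noteq> d y z" if "d y z < d x y"
    using isosceles[of z y x] assms that by (simp add: commute)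
  moreover have "d x z = d y z" if "\<not> d x z < d x y" "\<not> d y z < d x y"
    using ultrametric[of x z y] ultrametric[of y z x] assms that commute[of x y] by linarith
  ultimately show ?thesis
    unfolding distinguishes_def by blast
qed

section \<open>Generators\<close>

lemma generatorE:
  assumes "two_metric_generator M d S" "x \<in> M" "y \<in> M" "x \<noteq> y"
  obtains z w where "z \<in> S" "w \<in> S" "z \<in> M" "w \<in> M" "z \<noteq> w"
    "d x z < d x y \<or> d y z < d x y" "d x w < d x y \<or> d y w < d x y"
proof -
  obtain z w where zw: "z \<in> S" "w \<in> S" "z \<noteq> w" "distinguishes d z x y" "distinguishes d w x y"
    using assms unfolding two_metric_generator_def by blast
  moreover from zw have "z \<in> M" "w \<in> M"
    using assms(1) unfolding two_metric_generator_def by auto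
  ultimately show thesis
    using that assms by (auto simp: distinguishes_iff)
qed

lemma partnered_subset_generator:
  assumes "two_metric_generator M d S"
  shows "{x. partnered M d x} \<subseteq> S"
proof
  fix x assume "x \<in> {x. partnered M d x}"
  then obtain y where xy: "nearest x y" "nearest y x"
    by (auto simp: partnered_iff)
  have *: "z = x \<or> z = y" if "z \<in> M" "d x z < d x y \<or> d y z < d x y" for z
    using nearestD(5)[OF xy(1), of z] nearestD(5)[OF xy(2), of z] that
    by (cases "z = x"; cases "z = y") (auto simp: commute)
  obtain z w where "z \<in> S" "w \<in> S" "z \<in> M" "w \<in> M" "z \<noteq> w"
    "d x z < d x y \<or> d y z < d x y" "d x w < d x y \<or> d y w < d x y"
    using generatorE[OF assms] nearestD[OF xy(1)] by metis
  with * show "x \<in> S" by metis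
qed

text \<open>Two distinguishing points are needed here: the ball around \<open>x\<close> contributes only \<open>x\<close>.\<close>

lemma nearest_ball_meets_generator:
  assumes "two_metric_generator M d S" "nearest x y"
  obtains w where "w \<in> S" "w \<in> M" "d y w < d x y"
proof -
  obtain z w where "z \<in> S" "w \<in> S" "z \<in> M" "w \<in> M" "z \<noteq> w"
    "d x z < d x y \<or> d y z < d x y" "d x w < d x y \<or> d y w < d x y"
    using generatorE[OF assms(1)] nearestD[OF assms(2)] by metis
  moreover have "u = x \<or> d y u < d x y" if "u \<in> M" "d x u < d x y \<or> d y u < d x y" for u
    using nearestD(5)[OF assms(2), of u] that by (cases "u = x") auto
  ultimately show thesis
    using that by metis
qed

text \<open>Every point of the open ball of radius \<open>d x y\<close> around \<open>y\<close> has the same distance from \<open>x\<close> as \<open>y\<close>,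
  so \<open>y\<close> can be replaced by a point of \<open>S\<close> in that ball.\<close>

lemma nearest_in_generator:
  assumes "two_metric_generator M d S" "nearest x y"
  obtains w where "w \<in> S" "nearest x w"
proof -
  obtain w where w: "w \<in> S" "w \<in> M" "d y w < d x y"
    using nearest_ball_meets_generator[OF assms] by metis
  then have "d x w = d x y"
    using isosceles[of w y x] nearestD[OF assms(2)] by (simp add: commute)
  with w that nearest_cong[OF assms(2)] show thesis by blast
qed

lemma finite_generator_imp_nearest:
  assumes "two_metric_generator M d S" "finite S" "x \<in> M" "y \<in> M" "x \<noteq> y"
  shows "\<exists>y. nearest x y"
proof (rule ccontr)
  assume none: "\<nexists>y. nearest x y"
  have "S - {x} \<noteq> {}"
    using generatorE[OF assms(1,3,4,5)] by (metis Diff_iff empty_iff singletonD)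
  then obtain p where p: "p \<in> S - {x}" "\<And>w. w \<in> S - {x} \<Longrightarrow> d x p \<le> d x w"
    using arg_min_if_finite(1)[of "S - {x}" "d x"] arg_min_least[of "S - {x}" _ "d x"] assms(2)
    by (metis finite_Diff)
  have "p \<in> M"
    using p(1) assms(1) unfolding two_metric_generator_def by auto
  then obtain z where z: "z \<in> M" "z \<noteq> x" "d x z < d x p"
    using none p(1) assms(3) unfolding nearest_def by force
  have "w = x" if "w \<in> S" "w \<in> M" "d x w < d x z \<or> d z w < d x z" for w
  proof (rule ccontr)
    assume "w \<noteq> x"
    then have "d x z < d x w" using p(2)[of w] that z by auto
    then show False
      using isosceles[of z x w] that z assms(3) by (auto simp: commute)
  qed
  with generatorE[OF assms(1,3) z(1)] z(2) show False by metis
qed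

section \<open>Pseudopartnering sequences\<close>

text \<open>The points of the ball are closer to \<open>x\<close> than all others, so a minimal distance within the
  ball is a minimal distance in the whole space. The condition \<open>0 \<le> r\<close> lets the rule cover a
  sequence that has stopped, where \<open>r = 0\<close> and the ball is empty.\<close>

lemma pseudopartnering_step_iff:
  assumes x: "x \<in> M" and r: "0 \<le> r"
  shows "pseudopartnering_step M d x r x' r' \<longleftrightarrow>
    (if \<exists>y. nearest x y \<and> ereal (d x y) < r then nearest x x' \<and> r' = ereal (d x x')
     else x' = x \<and> r' = 0)"
proof -
  define B where "B = ext_ball M d r x"
  define I where "I = {d x z |z. z \<in> B - {x}}"
  have step: "pseudopartnering_step M d x r x' r' \<longleftrightarrow>
     (if card B = 1 \<or> r = 0 then x' = x \<and> r' = 0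
      else if \<exists>m. is_minimum I m
        then x' \<in> M \<and> is_minimum I (d x x') \<and> r' = ereal (d x x')
        else x' = x \<and> r' = 0)"
    unfolding pseudopartnering_step_def B_def I_def Let_def by simp
  have B: "z \<in> B \<longleftrightarrow> z \<in> M \<and> ereal (d x z) < r" for z
    unfolding B_def ext_ball_def by simp
  have min: "is_minimum I (d x y) \<longleftrightarrow> nearest x y \<and> ereal (d x y) < r" if y: "y \<in> M" for y
  proof
    assume m: "is_minimum I (d x y)"
    then obtain z where z: "z \<in> B - {x}" "d x y = d x z"
      unfolding is_minimum_def I_def by blast
    have "d x z \<le> d x w" if "w \<in> M - {x}" for w
    proof (cases "w \<in> B")
      case True
      then have "d x w \<in> I" using that unfolding I_def by blast
      then show ?thesis using m z unfolding is_minimum_def by simp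
    next
      case False
      then have "r \<le> ereal (d x w)" using that B by auto
      moreover have "ereal (d x z) < r" using z(1) B by auto
      ultimately have "ereal (d x z) < ereal (d x w)" by (rule order.strict_trans2[rotated])
      then show ?thesis by simp
    qed
    with x y z B show "nearest x y \<and> ereal (d x y) < r"
      unfolding nearest_def by auto
  next
    assume "nearest x y \<and> ereal (d x y) < r"
    then show "is_minimum I (d x y)"
      unfolding nearest_def is_minimum_def I_def using B by auto
  qed
  show ?thesis
  proof (cases "\<exists>y. nearest x y \<and> ereal (d x y) < r")
    case True
    then obtain y where y: "nearest x y" "ereal (d x y) < r" by blast
    then have "0 < r"
      using nearestD(4)[OF y(1)] by (metis ereal_less(2) order.strict_trans)
    then have "x \<in> B" "y \<in> B"
      using B x y nearestD[OF y(1)] by (auto simp flip: zero_ereal_def)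
    then have "card B \<noteq> 1"
      using nearestD(3)[OF y(1)] by (metis card_1_singletonE singletonD)
    moreover have "is_minimum I (d x y)"
      using min y nearestD by blast
    moreover have "x' \<in> M \<and> is_minimum I (d x x') \<longleftrightarrow> nearest x x'"
    proof
      assume "nearest x x'"
      moreover from this have "d x x' \<le> d x y"
        using y(1) nearestD by blast
      then have "ereal (d x x') < r"
        using y(2) by (metis ereal_less_eq(3) order.strict_trans1)
      ultimately show "x' \<in> M \<and> is_minimum I (d x x')"
        using min nearestD by blast
    qed (use min in blast)
    ultimately show ?thesis
      unfolding step using True \<open>0 < r\<close> by auto
  next
    case False
    have "\<not> is_minimum I m" for m
    proof
      assume m: "is_minimum I m"
      then obtain z where "z \<in> M" "m = d x z"
        unfolding is_minimum_def I_def using B by auto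
      with m min False show False by blast
    qed
    with False show ?thesis unfolding step by auto
  qed
qed

context
  fixes x s r
  assumes x: "x \<in> M" and seq: "pseudopartnering_seq M d x s r"
begin

lemma seq_0: "s 0 = x" "r 0 = \<infinity>"
  using seq unfolding pseudopartnering_seq_def by auto

lemma seq_carrier_radius: "s n \<in> M \<and> 0 \<le> r n"
proof (induction n)
  case 0
  then show ?case using seq_0 x by simp
next
  case (Suc n)
  have "pseudopartnering_step M d (s n) (r n) (s (Suc n)) (r (Suc n))"
    using seq unfolding pseudopartnering_seq_def by blast
  then show ?case
    using Suc by (auto simp: pseudopartnering_step_iff nearest_def split: if_splits)
qed

lemma seq_step:
  "if \<exists>y. nearest (s n) y \<and> ereal (d (s n) y) < r n
   then nearest (s n) (s (Suc n)) \<and> r (Suc n) = ereal (d (s n) (s (Suc n)))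
   else s (Suc n) = s n \<and> r (Suc n) = 0"
  using seq seq_carrier_radius[of n]
    pseudopartnering_step_iff[of "s n" "r n" "s (Suc n)" "r (Suc n)"]
  unfolding pseudopartnering_seq_def by blast

abbreviation gap :: "nat \<Rightarrow> real" where
  "gap n \<equiv> d (s n) (s (Suc n))"

lemma seq_carrier: "s n \<in> M"
  using seq_carrier_radius by blast

lemma radius_Suc: "r (Suc n) = ereal (gap n)"
  using seq_step[of n] seq_carrier[of n] by (auto simp: zero_ereal_def split: if_splits)

lemma gap_pos_imp_nearest: "0 < gap n \<Longrightarrow> nearest (s n) (s (Suc n))"
  using seq_step[of n] seq_carrier[of n] by (auto split: if_splits)

lemma gap_Suc_less:
  assumes "0 < gap (Suc n)"
  shows "gap (Suc n) < gap n"
proof -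
  obtain y where y: "nearest (s (Suc n)) y" "ereal (d (s (Suc n)) y) < r (Suc n)"
    using seq_step[of "Suc n"] seq_carrier[of "Suc n"] assms by (auto split: if_splits)
  have "gap (Suc n) \<le> d (s (Suc n)) y"
    using gap_pos_imp_nearest[OF assms] y(1) nearestD by blast
  with y(2) show ?thesis by (simp add: radius_Suc)
qed

lemma gap_less:
  assumes "m < n" "0 < gap n"
  shows "gap n < gap m"
  using assms
proof (induction n)
  case (Suc n)
  then have "gap (Suc n) < gap n" by (intro gap_Suc_less)
  with Suc show ?case by (cases "m = n") auto
qed simp

text \<open>Later steps are shorter than step \<open>m\<close>, so by the ultrametric inequality they do not change
  the distance to the point before step \<open>m\<close>.\<close>

lemma dist_later:
  assumes "m < n"
  shows "d (s m) (s n) = gap m"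
  using assms
proof (induction n)
  case (Suc n)
  show ?case
  proof (cases "m = n \<or> gap n = 0")
    case True
    then show ?thesis
      using Suc seq_carrier by (cases "m = n") auto
  next
    case False
    then have "m < n" "0 < gap n" using Suc.prems nonneg[of "s n" "s (Suc n)"] by linarith+
    then have "gap n < d (s m) (s n)"
      using gap_less Suc by simp
    then show ?thesis
      using isosceles[of "s (Suc n)" "s n" "s m"] seq_carrier Suc \<open>m < n\<close> by (simp add: commute)
  qed
qed simp

lemma pseudolimit_stopped:
  assumes "gap n = 0"
  shows "pseudolimit M d s z \<longleftrightarrow> z = s n"
proof
  assume "pseudolimit M d s z"
  then have "z \<in> M" "d z (s n) = 0" using assms unfolding pseudolimit_def by auto
  then show "z = s n" using seq_carrier by simp
next
  assume z: "z = s n"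
  have const: "s k = s n" if "n \<le> k" for k
    using dist_later[of n k] assms that seq_carrier by (cases "n = k") auto
  have "d (s n) (s k) = gap k" for k
  proof (cases "k < n")
    case True
    then show ?thesis using dist_later[of k n] by (simp add: commute)
  next
    case False
    then have "s k = s n" "s (Suc k) = s n" by (intro const; simp)+
    then show ?thesis by metis
  qed
  with z seq_carrier show "pseudolimit M d s z" unfolding pseudolimit_def by simp
qed

lemma pseudolimitI:
  assumes "z \<in> M" "\<And>n. d z (s (Suc n)) < gap n"
  shows "pseudolimit M d s z"
proof -
  have "d z (s n) = gap n" for n
    using isosceles[of z "s (Suc n)" "s n"] assms seq_carrier by (simp add: commute)
  with assms show ?thesis unfolding pseudolimit_def by simp
qed

lemma pseudolimit_exists:
  assumes S: "two_metric_generator M d S" and "finite S"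
  shows "\<exists>z. pseudolimit M d s z"
proof (cases "\<exists>n. gap n = 0")
  case True
  then show ?thesis using pseudolimit_stopped by blast
next
  case False
  then have pos: "0 < gap n" for n
    by (metis nonneg order_le_less)
  have "\<exists>w. w \<in> S \<and> w \<in> M \<and> d (s (Suc n)) w < gap n" for n
    using nearest_ball_meets_generator[OF S gap_pos_imp_nearest[OF pos]] by metis
  then obtain f where f: "f n \<in> S" "f n \<in> M" "d (s (Suc n)) (f n) < gap n" for n
    by metis
  \<comment> \<open>By the pigeonhole principle some value of \<open>f\<close> lies in infinitely many of the nested balls,
    hence in all.\<close>
  have "finite (range f)"
    using f(1) assms(2) by (meson finite_subset image_subsetI)
  then obtain k where inf: "infinite {n. f n = f k}"
    using pigeonhole_infinite[of UNIV f] by auto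
  have "d (f k) (s (Suc m)) < gap m" for m
  proof -
    obtain n where n: "m < n" "f n = f k"
      using inf by (metis (mono_tags, lifting) infinite_nat_iff_unbounded mem_Collect_eq)
    have "d (s (Suc m)) (s (Suc n)) = gap (Suc m)"
      using dist_later[of "Suc m" "Suc n"] n by simp
    also have "\<dots> < gap m" by (intro gap_Suc_less pos)
    finally have "d (s (Suc m)) (s (Suc n)) < gap m" .
    moreover have "d (s (Suc n)) (f k) < gap m"
      using f(3)[of n] gap_less[OF n(1) pos] n(2) by simp
    ultimately show ?thesis
      using ultrametric[of "s (Suc m)" "f k" "s (Suc n)"] seq_carrier f(2)
      by (fastforce simp: commute)
  qed
  then show ?thesis
    using pseudolimitI f(2) by blast
qed

lemma finite_pseudolimits_if_finite_range:
  assumes "finite (range s)"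
  shows "finite {z. pseudolimit M d s z}"
proof -
  have "\<not> inj s"
    using assms finite_imageD by blast
  then obtain m n where "m < n" "s m = s n"
    unfolding inj_def by (metis linorder_neqE_nat)
  then have "gap m = 0"
    using dist_later[of m n] seq_carrier by simp
  then show ?thesis
    by (simp add: pseudolimit_stopped)
qed

text \<open>The next step is sought in the open ball around \<open>s (Suc m)\<close> with \<open>s m\<close> on its boundary. If it
  does not exist although \<open>s (Suc m)\<close> has nearest neighbours, then \<open>s m\<close> must be one of them.\<close>

lemma stopped_imp_partners:
  assumes "\<exists>y. nearest (s (Suc m)) y" "0 < gap m" "gap (Suc m) = 0"
  shows "nearest (s m) (s (Suc m)) \<and> nearest (s (Suc m)) (s m)"
proof -
  obtain y where y: "nearest (s (Suc m)) y" using assms(1) by blast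
  have "\<not> nearest (s (Suc m)) (s (Suc (Suc m)))"
    using assms(3) nearestD(4) by fastforce
  then have "\<not> ereal (d (s (Suc m)) y) < r (Suc m)"
    using seq_step[of "Suc m"] y by (auto split: if_splits)
  then have "d (s (Suc m)) (s m) \<le> d (s (Suc m)) y"
    by (simp add: radius_Suc commute)
  moreover have "s m \<noteq> s (Suc m)"
    using assms(2) seq_carrier by fastforce
  ultimately have "nearest (s (Suc m)) (s m)"
    using y seq_carrier[of m] unfolding nearest_def by force
  with gap_pos_imp_nearest[OF assms(2)] show ?thesis by blast
qed

text \<open>A pseudolimit \<open>u\<close> is closer to \<open>s (Suc n)\<close> than to any point that is separated from the
  sequence at step \<open>n\<close>; so only pseudolimits can be nearest to \<open>u\<close>.\<close>

lemma nearest_pseudolimit: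
  assumes "\<And>n. 0 < gap n" "pseudolimit M d s u" "nearest u y"
  shows "pseudolimit M d s y"
proof (rule pseudolimitI)
  show "y \<in> M" using assms(3) nearestD by blast
  fix n
  have u: "u \<in> M" "d u (s (Suc n)) = gap (Suc n)"
    using assms(2) unfolding pseudolimit_def by auto
  then have "s (Suc n) \<noteq> u"
    using assms(1)[of "Suc n"] by auto
  then have "d u y \<le> gap (Suc n)"
    using nearestD(5)[OF assms(3) seq_carrier] u(2) by metis
  then have "d y (s (Suc n)) \<le> gap (Suc n)"
    using ultrametric[of y "s (Suc n)" u] u \<open>y \<in> M\<close> seq_carrier by (simp add: commute)
  also have "\<dots> < gap n" by (intro gap_Suc_less assms)
  finally show "d y (s (Suc n)) < gap n" .
qed

lemma pseudolimits_contain_partners: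
  assumes all: "\<And>u. u \<in> M \<Longrightarrow> \<exists>y. nearest u y"
    and pos: "\<And>n. 0 < gap n"
    and fin: "finite {z. pseudolimit M d s z}" and ex: "\<exists>z. pseudolimit M d s z"
  obtains u v where "pseudolimit M d s u" "pseudolimit M d s v" "nearest u v" "nearest v u"
proof -
  define N where "N = {(u, v). pseudolimit M d s u \<and> nearest u v}"
  have "N \<subseteq> {z. pseudolimit M d s z} \<times> {z. pseudolimit M d s z}"
    unfolding N_def using nearest_pseudolimit[OF pos] by blast
  then have "finite N" using fin by (meson finite_SigmaI finite_subset)
  have "N \<noteq> {}"
    using ex all unfolding N_def pseudolimit_def by blast
  define p where "p = arg_min_on (case_prod d) N"
  have p: "p \<in> N" "\<And>q. q \<in> N \<Longrightarrow> case_prod d p \<le> case_prod d q"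
    using arg_min_if_finite(1)[OF \<open>finite N\<close> \<open>N \<noteq> {}\<close>, of "case_prod d"]
      arg_min_least[OF \<open>finite N\<close> \<open>N \<noteq> {}\<close>, of _ "case_prod d"]
    unfolding p_def by blast+
  obtain u v where uv: "p = (u, v)" by fastforce
  have u: "pseudolimit M d s u" "nearest u v"
    using p(1) uv unfolding N_def by auto
  then have v: "pseudolimit M d s v" "v \<in> M"
    using nearest_pseudolimit[OF pos] nearestD by blast+
  obtain w where w: "nearest v w" using all v by blast
  then have "d v u \<le> d v w"
    using p(2)[of "(v, w)"] v uv unfolding N_def by (simp add: commute)
  then have "nearest v u"
    using w u(2) unfolding nearest_def by force
  with u v that show thesis by blast
qed

end

text \<open>Choosing every step inside \<open>S\<close> is possible by \<open>nearest_in_generator\<close>.\<close>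

lemma pseudopartnering_seq_in_generator:
  assumes S: "two_metric_generator M d S" and x: "x \<in> M"
  obtains s r where "pseudopartnering_seq M d x s r" "range s \<subseteq> insert x S"
proof -
  define Q where "Q = (\<lambda>(n::nat) (p::'a \<times> ereal).
    fst p \<in> insert x S \<and> fst p \<in> M \<and> 0 \<le> snd p \<and> (n = 0 \<longrightarrow> p = (x, \<infinity>)))"
  have "\<exists>p'. Q (Suc n) p' \<and> pseudopartnering_step M d (fst p) (snd p) (fst p') (snd p')"
    if p: "Q n p" for n p
  proof (cases "\<exists>y. nearest (fst p) y \<and> ereal (d (fst p) y) < snd p")
    case True
    then obtain w where w: "w \<in> S" "nearest (fst p) w"
      using nearest_in_generator[OF S] by metis
    then show ?thesis
      using p True nearestD[OF w(2)] unfolding Q_def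
      by (intro exI[of _ "(w, ereal (d (fst p) w))"]) (simp add: pseudopartnering_step_iff)
  next
    case False
    then show ?thesis
      using p unfolding Q_def
      by (intro exI[of _ "(fst p, 0)"]) (auto simp: pseudopartnering_step_iff)
  qed
  moreover have "Q 0 (x, \<infinity>)" using x unfolding Q_def by simp
  ultimately obtain f where f: "Q n (f n)"
    "pseudopartnering_step M d (fst (f n)) (snd (f n)) (fst (f (Suc n))) (snd (f (Suc n)))" for n
    using dependent_nat_choice[of Q
        "\<lambda>_ p p'. pseudopartnering_step M d (fst p) (snd p) (fst p') (snd p')"]
    by metis
  show thesis
  proof (rule that)
    show "pseudopartnering_seq M d x (fst \<circ> f) (snd \<circ> f)"
      using f(1)[of 0] f(2) unfolding pseudopartnering_seq_def Q_def by auto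
    show "range (fst \<circ> f) \<subseteq> insert x S"
      using f(1) unfolding Q_def by auto
  qed
qed

section \<open>Finite generators and pseudo-completeness\<close>

lemma finite_generator_imp_pseudo_complete:
  assumes "two_metric_generator M d S" "finite S"
  shows "pseudo_complete M d"
  unfolding pseudo_complete_def
proof (intro allI impI conjI)
  fix x assume "pseudopartnered M d x"
  then have x: "x \<in> M" unfolding pseudopartnered_def by blast
  show "\<exists>z. pseudolimit M d s z" if "pseudopartnering_seq M d x s r" for s r
    using pseudolimit_exists[OF x that assms] .
  obtain s r where s: "pseudopartnering_seq M d x s r" "range s \<subseteq> insert x S"
    using pseudopartnering_seq_in_generator[OF assms(1) x] .
  then have "finite {z. pseudolimit M d s z}"
    using finite_pseudolimits_if_finite_range[OF x s(1)] assms(2)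
    by (meson finite_insert finite_subset)
  with s(1) show "\<exists>s r. pseudopartnering_seq M d x s r \<and> finite {z. pseudolimit M d s z}"
    by blast
qed

lemma pseudopartnered_near_partners:
  assumes "pseudo_complete M d" and all: "\<And>u. u \<in> M \<Longrightarrow> \<exists>y. nearest u y"
    and "pseudopartnered M d x"
  obtains u v where "nearest x u" "nearest x v" "nearest u v" "nearest v u"
proof -
  have x: "x \<in> M" and np: "\<not> partnered M d x"
    using assms(3) unfolding pseudopartnered_def by auto
  obtain s r where seq: "pseudopartnering_seq M d x s r"
    and fin: "finite {z. pseudolimit M d s z}" and ex: "\<exists>z. pseudolimit M d s z"
    using assms(1,3) unfolding pseudo_complete_def by metis
  note s0 = seq_0[OF x seq]
  have x1: "nearest x (s 1)"
    using seq_step[OF x seq, of 0] all[OF x] s0 by auto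
  have *: "nearest x u" if "u \<in> M" "d x u = d x (s 1)" for u
    using nearest_cong[OF x1 that] .
  show thesis
  proof (cases "\<exists>n. d (s n) (s (Suc n)) = 0")
    case True
    define n where "n = (LEAST n. d (s n) (s (Suc n)) = 0)"
    have n: "d (s n) (s (Suc n)) = 0" "\<And>m. m < n \<Longrightarrow> d (s m) (s (Suc m)) \<noteq> 0"
      using LeastI_ex[OF True] not_less_Least unfolding n_def by blast+
    have "n \<noteq> 0" using n(1) nearestD(4)[OF x1] s0 by (auto intro!: Nat.gr0I)
    then obtain m where m: "n = Suc m" using not0_implies_Suc by blast
    then have "0 < d (s m) (s (Suc m))"
      using n(2)[of m] nonneg[of "s m" "s (Suc m)"] by linarith
    then have pair: "nearest (s m) (s (Suc m))" "nearest (s (Suc m)) (s m)"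
      using stopped_imp_partners[OF x seq] all seq_carrier[OF x seq] n(1) m by blast+
    have "m \<noteq> 0" using np pair s0 unfolding partnered_iff by metis
    have "nearest x (s k)" if "0 < k" for k
      using * dist_later[OF x seq that] seq_carrier[OF x seq] s0 by simp
    then have "nearest x (s m)" "nearest x (s (Suc m))" using \<open>m \<noteq> 0\<close> by blast+
    with pair that show thesis by blast
  next
    case False
    then have "0 < d (s n) (s (Suc n))" for n
      by (metis nonneg order_le_less)
    then obtain u v where uv: "pseudolimit M d s u" "pseudolimit M d s v" "nearest u v" "nearest v u"
      using pseudolimits_contain_partners[OF x seq all _ fin ex] by blast
    have "nearest x z" if "pseudolimit M d s z" for z
      using that * s0 unfolding pseudolimit_def by (metis One_nat_def commute)
    with uv that show thesis by blast
  qed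
qed

text \<open>If the open ball of radius \<open>d x y\<close> around one of the two points, say \<open>x\<close>, contains another
  point, then it contains the nearest neighbours of \<open>x\<close>, hence two partners. Otherwise \<open>x\<close> and \<open>y\<close>
  are themselves partners.\<close>

lemma partnered_generator:
  assumes "pseudo_complete M d" and all: "\<And>u. u \<in> M \<Longrightarrow> \<exists>y. nearest u y"
  shows "two_metric_generator M d {x. partnered M d x}"
proof -
  have sub: "{x. partnered M d x} \<subseteq> M" unfolding partnered_def by blast
  have near: "\<exists>u v. partnered M d u \<and> partnered M d v \<and> u \<noteq> v \<and> d x u < \<delta> \<and> d x v < \<delta>"
    if x': "nearest x x'" "d x x' < \<delta>" for x x' \<delta>
  proof -
    have close: "d x u < \<delta>" if "nearest x u" for u
      using nearestD(5)[OF that, of x'] nearestD(2,3)[OF x'(1)] x'(2) by auto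
    show ?thesis
    proof (cases "partnered M d x")
      case True
      then obtain y where "nearest x y" "nearest y x" unfolding partnered_iff by blast
      moreover have "d x x < \<delta>"
        using x' nearestD(1,4)[OF x'(1)] by auto
      ultimately show ?thesis
        using close True nearestD(3) unfolding partnered_iff by blast
    next
      case False
      then have "pseudopartnered M d x"
        using x' unfolding pseudopartnered_iff by blast
      then obtain u v where "nearest x u" "nearest x v" "nearest u v" "nearest v u"
        using pseudopartnered_near_partners[OF assms] by metis
      then show ?thesis
        using close nearestD(3) unfolding partnered_iff by blast
    qed
  qed
  have "\<exists>u\<in>{x. partnered M d x}. \<exists>v\<in>{x. partnered M d x}.
      u \<noteq> v \<and> distinguishes d u x y \<and> distinguishes d v x y"
    if xy: "x \<in> M" "y \<in> M" "x \<noteq> y" for x y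
  proof -
    have dist: "distinguishes d u x y" if "partnered M d u" "d x u < d x y \<or> d y u < d x y" for u
      using distinguishes_iff[OF xy(1,2), of u] sub that by blast
    obtain x' y' where x': "nearest x x'" and y': "nearest y y'" using all xy by blast
    consider "d x x' < d x y" | "d y y' < d x y" | "d x y \<le> d x x'" "d x y \<le> d y y'"
      by linarith
    then show ?thesis
    proof cases
      case 1
      then show ?thesis using near[OF x'] dist by blast
    next
      case 2
      then show ?thesis using near[OF y'] dist by blast
    next
      case 3
      then have "nearest x y" "nearest y x"
        using x' y' xy unfolding nearest_def by (force simp: commute)+
      then have "partnered M d x" "partnered M d y" unfolding partnered_iff by blast+
      moreover have "d x x < d x y" "d y y < d x y" using xy by auto
      ultimately show ?thesis using xy dist by blast
    qed
  qed
  with sub show ?thesis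
    unfolding two_metric_generator_def by blast
qed

end

theorem mainTheorem5:
  fixes X :: "'a set" and d :: "'a \<Rightarrow> 'a \<Rightarrow> real"
  assumes "Ultrametric_space X d"
    and "\<exists>x\<in>X. \<exists>y\<in>X. x \<noteq> y"
  shows "(\<exists>S. finite S \<and> two_metric_basis X d S) \<longleftrightarrow>
    pseudo_complete X d \<and> finite {x. partnered X d x} \<and> {x. unpartnered X d x} = {}"
proof -
  interpret Ultrametric_space X d by fact
  show ?thesis
  proof
    assume "\<exists>S. finite S \<and> two_metric_basis X d S"
    then obtain S where S: "finite S" "two_metric_generator X d S"
      unfolding two_metric_basis_def by blast
    have "\<exists>y. nearest x y" if "x \<in> X" for x
      using finite_generator_imp_nearest[OF S(2,1) that] assms(2) by metis
    then have "{x. unpartnered X d x} = {}"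
      unfolding unpartnered_iff by blast
    moreover have "finite {x. partnered X d x}"
      using partnered_subset_generator[OF S(2)] S(1) finite_subset by blast
    ultimately show "pseudo_complete X d \<and> finite {x. partnered X d x} \<and>
        {x. unpartnered X d x} = {}"
      using finite_generator_imp_pseudo_complete[OF S(2,1)] by blast
  next
    assume R: "pseudo_complete X d \<and> finite {x. partnered X d x} \<and> {x. unpartnered X d x} = {}"
    then have "\<exists>y. nearest x y" if "x \<in> X" for x
      using that unfolding unpartnered_iff by blast
    with R have "two_metric_generator X d {x. partnered X d x}"
      using partnered_generator by blast
    then have "two_metric_basis X d {x. partnered X d x}"
      unfolding two_metric_basis_def
      using partnered_subset_generator subset_imp_lepoll by blast
    with R show "\<exists>S. finite S \<and> two_metric_basis X d S" by blast
  qed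
qed

end
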